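(* Let $\lambda\in\mathbb{C}^*$, $\alpha\in\mathbb{C}$, $h(t)\in\mathbb{C}[t]$. Then the $\mathfrak{S}^{\frac12}$-module $\Omega_{\mathfrak{S}^{\frac12}}(\lambda,\alpha,h)$ is simple if and only if $\alpha\neq0$.
   Context: All vector spaces are over $\mathbb{C}$. The Neveu-Schwarz type super-BMS$_3$ algebra $\mathfrak{S}^{\frac12}$ is the Lie superalgebra with basis $\{L_m,W_m,G_r,C_1,C_2\mid m\in\mathbb{Z},r\in\frac12+\mathbb{Z}\}$, where $L_m,W_m,C_1,C_2$ are even, the $G_r$ are odd, $C_1,C_2$ are central, and the non-trivial brackets are $$[L_m,L_n]=(n-m)L_{m+n}+\tfrac{n^3-n}{12}\delta_{m+n,0}C_1,\quad [L_m,W_n]=(n-m)W_{m+n}+\tfrac{n^3-n}{12}\delta_{m+n,0}C_2,$$ $$[L_m,G_r]=(r-\tfrac m2)G_{m+r},\quad [G_r,G_s]=2W_{r+s}+\tfrac13(r^2-\tfrac14)\delta_{r+s,0}C_2.$$ Modules over a Lie superalgebra (and their submodules) are $\mathbb{Z}_2$-graded, with $x(yv)-(-1)^{|x||y|}y(xv)=[x,y]v$ for homogeneous $x,y$. Simple means nonzero with no nonzero proper ($\mathbb{Z}_2$-graded) submodule. For a polynomial $h$, $\alpha\in\mathbb{C}$ and $m\in\mathbb{Z}$, $h_m(t)=m\,h(t)-m(m-1)\alpha\,\frac{h(t)-h(\alpha)}{t-\alpha}\in\mathbb{C}[t]$. $\Omega_{\mathfrak{S}^{\frac12}}(\lambda,\alpha,h)$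 is the $\mathfrak{S}^{\frac12}$-module with underlying space $M=\mathbb{C}[t,s]\oplus\mathbb{C}[y,x]$, $M_{\bar 0}=\mathbb{C}[t,s]$, $M_{\bar 1}=\mathbb{C}[y,x]$, and action (for $m\in\mathbb{Z}$, $r\in\frac12+\mathbb{Z}$, $f(t,s)\in\mathbb{C}[t,s]$, $k(y,x)\in\mathbb{C}[y,x]$) $$L_mf(t,s)=\lambda^m(s+h_m(t))f(t,s-m)-m\lambda^m(t-m\alpha)\tfrac{\partial}{\partial t}(f(t,s-m)),$$ $$L_mk(y,x)=\lambda^m(x-\tfrac m2+h_m(y))k(y,x-m)-m\lambda^m(y-m\alpha)\tfrac{\partial}{\partial y}k(y,x-m),$$ $$W_mf(t,s)=\lambda^m(t-m\alpha)f(t,s-m),\quad W_mk(y,x)=\lambda^m(y-m\alpha)k(y,x-m),$$ $$G_rf(t,s)=\lambda^{r-\frac12}f(y,x-r)\in\mathbb{C}[y,x],\quad G_rk(y,x)=\lambda^{r+\frac12}(t-2r\alpha)k(t,s-r)\in\mathbb{C}[t,s],$$ with $C_1,C_2$ acting as $0$. *)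

theory Defs
  imports
    Complex_Main
    "HOL-Library.Poly_Mapping"
    "HOL-Library.Product_Plus"
    "HOL-Library.Z2"
    "HOL-Computational_Algebra.Polynomial"
begin

text \<open>The grading group is the type \<open>bit\<close> (the field with two elements);
  \<open>V 0\<close> and \<open>V 1\<close> are the even and the odd part.\<close>

locale super_vector_space = vector_space scale
  for scale :: "complex \<Rightarrow> 'v::ab_group_add \<Rightarrow> 'v" +
  fixes V :: "bit \<Rightarrow> 'v set"
  assumes subspace_part: "subspace (V i)"
    and parts_inter: "V 0 \<inter> V 1 = {0}"
    and parts_sum: "\<exists>u\<in>V 0. \<exists>w\<in>V 1. v = u + w"

definition super_sign :: "bit \<Rightarrow> bit \<Rightarrow> complex" where
  "super_sign i j = (if i = 1 \<and> j = 1 then - 1 else 1)"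

locale lie_superalgebra = super_vector_space scale \<g>
  for scale :: "complex \<Rightarrow> 'g::ab_group_add \<Rightarrow> 'g" and \<g> :: "bit \<Rightarrow> 'g set" +
  fixes bracket :: "'g \<Rightarrow> 'g \<Rightarrow> 'g"
  assumes bracket_linear_right: "Vector_Spaces.linear scale scale (\<lambda>y. bracket x y)"
    and bracket_linear_left: "Vector_Spaces.linear scale scale (\<lambda>x. bracket x y)"
    and bracket_graded: "\<lbrakk>x \<in> \<g> i; y \<in> \<g> j\<rbrakk> \<Longrightarrow> bracket x y \<in> \<g> (i + j)"
    and super_skew: "\<lbrakk>x \<in> \<g> i; y \<in> \<g> j\<rbrakk> \<Longrightarrow>
      bracket x y = - scale (super_sign i j) (bracket y x)"
    and super_jacobi: "\<lbrakk>x \<in> \<g> i; y \<in> \<g> j; z \<in> \<g> k\<rbrakk> \<Longrightarrow>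
      bracket x (bracket y z) =
        bracket (bracket x y) z + scale (super_sign i j) (bracket y (bracket x z))"

locale lie_supermodule =
  lie_superalgebra scaleg \<g> bracket + M: super_vector_space scale V
  for scaleg :: "complex \<Rightarrow> 'g::ab_group_add \<Rightarrow> 'g" and \<g> :: "bit \<Rightarrow> 'g set"
    and bracket :: "'g \<Rightarrow> 'g \<Rightarrow> 'g"
    and scale :: "complex \<Rightarrow> 'v::ab_group_add \<Rightarrow> 'v" and V :: "bit \<Rightarrow> 'v set" +
  fixes act :: "'g \<Rightarrow> 'v \<Rightarrow> 'v"
  assumes act_linear_right: "Vector_Spaces.linear scale scale (\<lambda>v. act x v)"
    and act_linear_left: "Vector_Spaces.linear scaleg scale (\<lambda>x. act x v)"
    and act_graded: "\<lbrakk>x \<in> \<g> i; v \<in> V j\<rbrakk> \<Longrightarrow> act x v \<in> V (i + j)"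
    and act_bracket: "\<lbrakk>x \<in> \<g> i; y \<in> \<g> j\<rbrakk> \<Longrightarrow>
      act x (act y v) - scale (super_sign i j) (act y (act x v)) = act (bracket x y) v"
begin

definition graded_submodule :: "'v set \<Rightarrow> bool" where
  "graded_submodule N \<longleftrightarrow> M.subspace N \<and> (\<forall>x. \<forall>v\<in>N. act x v \<in> N) \<and>
     (\<forall>v\<in>N. \<exists>u\<in>N \<inter> V 0. \<exists>w\<in>N \<inter> V 1. v = u + w)"

end

locale simple_lie_supermodule =
  lie_supermodule scaleg \<g> bracket scale V act
  for scaleg :: "complex \<Rightarrow> 'g::ab_group_add \<Rightarrow> 'g" and \<g> :: "bit \<Rightarrow> 'g set"
    and bracket :: "'g \<Rightarrow> 'g \<Rightarrow> 'g"
    and scale :: "complex \<Rightarrow> 'v::ab_group_add \<Rightarrow> 'v" and V :: "bit \<Rightarrow> 'v set"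
    and act :: "'g \<Rightarrow> 'v \<Rightarrow> 'v" +
  assumes nonzero: "\<exists>v :: 'v. v \<noteq> 0"
    and no_proper_submodule: "graded_submodule N \<Longrightarrow> N = {0} \<or> N = UNIV"

text \<open>The constructor \<open>G k\<close> stands for the odd basis element $G_r$ with $r = k + 1/2$;
  thus $[G_r, G_s]$ for $r = j + 1/2$, $s = k + 1/2$ has index $r + s = j + k + 1$.
  The algebra is the space of finitely supported functions on the basis.\<close>

datatype bms_basis = L int | W int | G int | C1 | C2

type_synonym bms = "bms_basis \<Rightarrow>\<^sub>0 complex"

definition half :: "int \<Rightarrow> complex" where
  "half k = of_int k + 1 / 2"

definition bms_scale :: "complex \<Rightarrow> bms \<Rightarrow> bms" where
  "bms_scale c x = Poly_Mapping.map (\<lambda>z. c * z) x"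

fun parity :: "bms_basis \<Rightarrow> bit" where
  "parity (G k) = 1"
| "parity _ = 0"

definition bms_part :: "bit \<Rightarrow> bms set" where
  "bms_part i = {x. \<forall>a\<in>Poly_Mapping.keys x. parity a = i}"

fun basis_bracket :: "bms_basis \<Rightarrow> bms_basis \<Rightarrow> bms" where
  "basis_bracket (L m) (L n) = Poly_Mapping.single (L (m + n)) (of_int (n - m)) +
     (if m + n = 0 then Poly_Mapping.single C1 (of_int (n ^ 3 - n) / 12) else 0)"
| "basis_bracket (L m) (W n) = Poly_Mapping.single (W (m + n)) (of_int (n - m)) +
     (if m + n = 0 then Poly_Mapping.single C2 (of_int (n ^ 3 - n) / 12) else 0)"
| "basis_bracket (W n) (L m) = - (Poly_Mapping.single (W (m + n)) (of_int (n - m)) +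
     (if m + n = 0 then Poly_Mapping.single C2 (of_int (n ^ 3 - n) / 12) else 0))"
| "basis_bracket (L m) (G k) = Poly_Mapping.single (G (m + k)) (half k - of_int m / 2)"
| "basis_bracket (G k) (L m) = - Poly_Mapping.single (G (m + k)) (half k - of_int m / 2)"
| "basis_bracket (G j) (G k) = Poly_Mapping.single (W (j + k + 1)) 2 +
     (if j + k + 1 = 0 then Poly_Mapping.single C2 ((half j ^ 2 - 1 / 4) / 3) else 0)"
| "basis_bracket _ _ = 0"

definition bms_bracket :: "bms \<Rightarrow> bms \<Rightarrow> bms" where
  "bms_bracket x y = (\<Sum>a\<in>Poly_Mapping.keys x. \<Sum>b\<in>Poly_Mapping.keys y.
     bms_scale (Poly_Mapping.lookup x a * Poly_Mapping.lookup y b) (basis_bracket a b))"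

text \<open>A bivariate polynomial $f(t,s)$ is an element of $(\mathbb{C}[t])[s]$, i.e. a polynomial
  in \<open>s\<close> with coefficients in $\mathbb{C}[t]$ (and similarly for $k(y,x)$, with \<open>y\<close> as the
  coefficient variable). The first component of a pair is the even part $\mathbb{C}[t,s]$,
  the second one the odd part $\mathbb{C}[y,x]$.\<close>

type_synonym omega_space = "complex poly poly \<times> complex poly poly"

definition omega_scale :: "complex \<Rightarrow> omega_space \<Rightarrow> omega_space" where
  "omega_scale c v = (smult [:c:] (fst v), smult [:c:] (snd v))"

definition omega_part :: "bit \<Rightarrow> omega_space set" where
  "omega_part i = (if i = 0 then {v. snd v = 0} else {v. fst v = 0})"

text \<open>\<open>shift c f\<close> is $f(t, s - c)$, \<open>dt f\<close> is the partial derivative in the coefficient variable,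
  and \<open>svar\<close> is the outer variable \<open>s\<close> (resp. \<open>x\<close>).\<close>

definition shift :: "complex \<Rightarrow> complex poly poly \<Rightarrow> complex poly poly" where
  "shift c f = pcompose f [:[:- c:], 1:]"

definition dt :: "complex poly poly \<Rightarrow> complex poly poly" where
  "dt f = map_poly pderiv f"

definition svar :: "complex poly poly" where
  "svar = [:0, 1:]"

text \<open>The division by $t - \alpha$ is exact.\<close>

definition hpoly :: "complex \<Rightarrow> complex poly \<Rightarrow> int \<Rightarrow> complex poly" where
  "hpoly \<alpha> h m = smult (of_int m) h
     - smult (of_int (m * (m - 1)) * \<alpha>) ((h - [:poly h \<alpha>:]) div [:- \<alpha>, 1:])"

text \<open>With $r = k + 1/2$, the exponents $r - 1/2$ and $r + 1/2$ are \<open>k\<close> and \<open>k + 1\<close>.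
  \<open>[:- c, 1:]\<close> is the polynomial $t - c$.\<close>

fun basis_act :: "complex \<Rightarrow> complex \<Rightarrow> complex poly \<Rightarrow> bms_basis \<Rightarrow> omega_space \<Rightarrow> omega_space"
where
  "basis_act lam \<alpha> h (L m) (f, k) =
     (smult [:lam powi m:] ((svar + [:hpoly \<alpha> h m:]) * shift (of_int m) f)
        - smult (smult (of_int m * lam powi m) [:- of_int m * \<alpha>, 1:]) (dt (shift (of_int m) f)),
      smult [:lam powi m:] ((svar - [:[:of_int m / 2:]:] + [:hpoly \<alpha> h m:]) * shift (of_int m) k)
        - smult (smult (of_int m * lam powi m) [:- of_int m * \<alpha>, 1:]) (dt (shift (of_int m) k)))"
| "basis_act lam \<alpha> h (W m) (f, k) =
     (smult (smult (lam powi m) [:- of_int m * \<alpha>, 1:]) (shift (of_int m) f),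
      smult (smult (lam powi m) [:- of_int m * \<alpha>, 1:]) (shift (of_int m) k))"
| "basis_act lam \<alpha> h (G j) (f, k) =
     (smult (smult (lam powi (j + 1)) [:- 2 * half j * \<alpha>, 1:]) (shift (half j) k),
      smult [:lam powi j:] (shift (half j) f))"
| "basis_act lam \<alpha> h C1 v = 0"
| "basis_act lam \<alpha> h C2 v = 0"

definition omega_act :: "complex \<Rightarrow> complex \<Rightarrow> complex poly \<Rightarrow> bms \<Rightarrow> omega_space \<Rightarrow> omega_space"
where
  "omega_act lam \<alpha> h x v =
     (\<Sum>a\<in>Poly_Mapping.keys x. omega_scale (Poly_Mapping.lookup x a) (basis_act lam \<alpha> h a v))"

lemma lookup_bms_scale: "Poly_Mapping.lookup (bms_scale c x) a = c * Poly_Mapping.lookup x a"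
  by (auto simp: bms_scale_def Poly_Mapping.map.rep_eq when_def)

lemma bms_scale_single: "bms_scale c (Poly_Mapping.single a d) = Poly_Mapping.single a (c * d)"
  by (rule poly_mapping_eqI) (simp add: lookup_bms_scale lookup_single when_def)

interpretation bms: vector_space bms_scale
  by unfold_locales
    (rule poly_mapping_eqI, simp add: lookup_bms_scale lookup_add algebra_simps)+

interpretation omega: vector_space omega_scale
  apply unfold_locales
  apply (auto simp: omega_scale_def prod_eq_iff smult_add_right mult.commute
     simp flip: smult_add_left one_pCons)
  done

lemma bms_part_induct [consumes 1, case_names zero add basis]:
  assumes "x \<in> bms_part i" and "P 0" and "\<And>x y. P x \<Longrightarrow> P y \<Longrightarrow> P (x + y)"
    and "\<And>a c. parity a = i \<Longrightarrow> P (bms_scale c (Poly_Mapping.single a 1))"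
  shows "P x"
proof -
  have *: "P (\<Sum>a\<in>A. bms_scale (Poly_Mapping.lookup x a) (Poly_Mapping.single a 1))"
    if "finite A" "A \<subseteq> Poly_Mapping.keys x" for A
    using that assms by (induction A rule: finite_induct) (auto simp: bms_part_def)
  have "x = (\<Sum>a\<in>Poly_Mapping.keys x. bms_scale (Poly_Mapping.lookup x a) (Poly_Mapping.single a 1))"
    by (rule poly_mapping_eqI)
      (simp add: lookup_sum lookup_bms_scale lookup_single when_def if_distrib[of "(*) _"]
        in_keys_iff cong: if_cong)
  with *[of "Poly_Mapping.keys x"] show ?thesis by simp
qed

lemma ext_linear:
  assumes "vector_space sc"
  shows "Vector_Spaces.linear bms_scale sc
     (\<lambda>x. \<Sum>a\<in>Poly_Mapping.keys x. sc (Poly_Mapping.lookup x a) (F a))"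
proof -
  interpret v: vector_space sc by fact
  have eq: "(\<Sum>a\<in>Poly_Mapping.keys x. sc (Poly_Mapping.lookup x a) (F a))
      = (\<Sum>a\<in>S. sc (Poly_Mapping.lookup x a) (F a))"
    if "finite S" "Poly_Mapping.keys x \<subseteq> S" for x S
    using that by (intro sum.mono_neutral_left) (auto simp: in_keys_iff)
  show ?thesis
  proof unfold_locales
    fix x y :: bms
    let ?S = "Poly_Mapping.keys x \<union> Poly_Mapping.keys y"
    have "Poly_Mapping.keys (x + y) \<subseteq> ?S" by (rule keys_add)
    then show "(\<Sum>a\<in>Poly_Mapping.keys (x + y). sc (Poly_Mapping.lookup (x + y) a) (F a)) =
       (\<Sum>a\<in>Poly_Mapping.keys x. sc (Poly_Mapping.lookup x a) (F a)) +
       (\<Sum>a\<in>Poly_Mapping.keys y. sc (Poly_Mapping.lookup y a) (F a))"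
      using eq[of ?S "x + y"] eq[of ?S x] eq[of ?S y]
      by (simp add: lookup_add v.scale_left_distrib sum.distrib)
  next
    fix c x
    have "Poly_Mapping.keys (bms_scale c x) \<subseteq> Poly_Mapping.keys x"
      by (auto simp: in_keys_iff lookup_bms_scale)
    then show "(\<Sum>a\<in>Poly_Mapping.keys (bms_scale c x). sc (Poly_Mapping.lookup (bms_scale c x) a) (F a)) =
       sc c (\<Sum>a\<in>Poly_Mapping.keys x. sc (Poly_Mapping.lookup x a) (F a))"
      using eq[of "Poly_Mapping.keys x" "bms_scale c x"] by (simp add: lookup_bms_scale v.scale_sum_right)
  qed
qed

lemma bms_bracket_linear_left: "Vector_Spaces.linear bms_scale bms_scale (\<lambda>x. bms_bracket x y)"
  using ext_linear[OF bms.vector_space_axioms,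
      of "\<lambda>a. \<Sum>b\<in>Poly_Mapping.keys y. bms_scale (Poly_Mapping.lookup y b) (basis_bracket a b)"]
  by (simp add: bms_bracket_def bms.scale_sum_right)

lemma bms_bracket_linear_right: "Vector_Spaces.linear bms_scale bms_scale (\<lambda>y. bms_bracket x y)"
proof -
  have "bms_bracket x y = (\<Sum>b\<in>Poly_Mapping.keys y. bms_scale (Poly_Mapping.lookup y b)
      (\<Sum>a\<in>Poly_Mapping.keys x. bms_scale (Poly_Mapping.lookup x a) (basis_bracket a b)))" for y
    unfolding bms_bracket_def
    by (subst sum.swap) (simp add: bms.scale_sum_right mult.commute)
  then show ?thesis
    using ext_linear[OF bms.vector_space_axioms] by presburger
qed

interpretation brl: Vector_Spaces.linear bms_scale bms_scale "\<lambda>x. bms_bracket x y" for y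
  by (rule bms_bracket_linear_left)
interpretation brr: Vector_Spaces.linear bms_scale bms_scale "\<lambda>y. bms_bracket x y" for x
  by (rule bms_bracket_linear_right)

lemma bms_bracket_single:
  "bms_bracket (Poly_Mapping.single a c) (Poly_Mapping.single b d) =
     bms_scale (c * d) (basis_bracket a b)"
  by (simp add: bms_bracket_def)

lemmas br_simps = brl.add brl.neg brl.zero brl.scale brr.add brr.neg brr.zero brr.scale

lemma bms_part_iff: "x \<in> bms_part i \<longleftrightarrow> (\<forall>a. parity a \<noteq> i \<longrightarrow> Poly_Mapping.lookup x a = 0)"
  by (auto simp: bms_part_def in_keys_iff)

lemma bms_part_subspace: "bms.subspace (bms_part i)"
  unfolding bms.subspace_def
  by (auto simp: bms_part_iff lookup_bms_scale lookup_add)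

lemma single_in_part: "c = 0 \<or> parity a = i \<Longrightarrow> Poly_Mapping.single a c \<in> bms_part i"
  by (auto simp: bms_part_def in_keys_iff lookup_single when_def split: if_splits)

lemma bms_super_vector_space: "super_vector_space bms_scale bms_part"
proof unfold_locales
  show "bms_part 0 \<inter> bms_part 1 = {0}"
    by (auto simp: bms_part_def in_keys_iff intro!: poly_mapping_eqI)
next
  fix v :: bms
  show "\<exists>u\<in>bms_part 0. \<exists>w\<in>bms_part 1. v = u + w"
  proof -
    have "v = (\<Sum>a\<in>Poly_Mapping.keys v. Poly_Mapping.single a (Poly_Mapping.lookup v a))"
    by (rule poly_mapping_eqI)
      (simp add: lookup_sum lookup_single when_def in_keys_iff)
    moreover have "\<exists>u\<in>bms_part 0. \<exists>w\<in>bms_part 1.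
        (\<Sum>a\<in>A. Poly_Mapping.single a (Poly_Mapping.lookup v a)) = u + w" if "finite A" for A
      using that
    proof (induction A rule: finite_induct)
      case empty
      show ?case by (intro bexI[of _ 0]) (simp_all add: bms_part_def)
    next
      case (insert a A)
      then obtain u w where uw: "u \<in> bms_part 0" "w \<in> bms_part 1"
        "(\<Sum>a\<in>A. Poly_Mapping.single a (Poly_Mapping.lookup v a)) = u + w" by auto
      let ?s = "Poly_Mapping.single a (Poly_Mapping.lookup v a)"
      show ?case
      proof (cases "parity a = 0")
        case True
        then have "?s + u \<in> bms_part 0" using uw single_in_part
          by (intro bms.subspace_add[OF bms_part_subspace]) auto
        then show ?thesis using uw insert
          by (intro bexI[of _ "?s + u"] bexI[of _ w]) (auto simp: add.assoc)
      next
        case False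
        then have "?s + w \<in> bms_part 1" using uw single_in_part
          by (intro bms.subspace_add[OF bms_part_subspace]) auto
        then show ?thesis using uw insert
          by (intro bexI[of _ u] bexI[of _ "?s + w"]) (auto simp: ac_simps)
      qed
    qed
    ultimately show ?thesis using finite_keys by metis
  qed
qed (rule bms_part_subspace)

lemma half_sq_eq: "j + k + 1 = 0 \<Longrightarrow> (half k)\<^sup>2 = (half j)\<^sup>2"
proof -
  assume "j + k + 1 = 0"
  then have k: "k = - j - 1" by simp
  show ?thesis unfolding k by (simp add: half_def power2_eq_square field_simps)
qed

declare basis_bracket.simps [simp del]

definition coc :: "int \<Rightarrow> int \<Rightarrow> complex" where
  "coc m n = (if m + n = 0 then of_int (n ^ 3 - n) / 12 else 0)"

definition gcoc :: "int \<Rightarrow> int \<Rightarrow> complex" where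
  "gcoc j k = (if j + k + 1 = 0 then (half j ^ 2 - 1 / 4) / 3 else 0)"

lemma coc_skew: "coc n m = - coc m n"
proof (cases "m + n = 0")
  case True
  then have "m = - n" by simp
  then show ?thesis by (simp add: coc_def field_simps)
qed (simp add: coc_def add.commute)

lemma gcoc_sym: "gcoc k j = gcoc j k"
  by (auto simp: gcoc_def add.commute[of k j] dest: half_sq_eq)

lemma coc_jacobi: "of_int (p - n) * coc m (n + p) = of_int (n - m) * coc (m + n) p + of_int (p - m) * coc n (m + p)"
proof (cases "m + n + p = 0")
  case True
  then have p: "p = - m - n" by simp
  show ?thesis unfolding p
    by (simp add: coc_def power3_eq_cube field_simps)
next
  case False
  then show ?thesis by (simp add: coc_def add_ac)
qed

lemma gcoc_jacobi: "2 * coc m (j + k + 1) = (half j - of_int m / 2) * gcoc (m + j) k + (half k - of_int m / 2) * gcoc j (m + k)"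
proof (cases "m + j + k + 1 = 0")
  case True
  then have p: "k = - m - j - 1" by simp
  show ?thesis unfolding p
    by (simp add: coc_def gcoc_def half_def power2_eq_square power3_eq_cube field_simps)
next
  case False
  then show ?thesis by (simp add: coc_def gcoc_def add_ac)
qed

lemma bb_simps:
  "basis_bracket (L m) (L n) = Poly_Mapping.single (L (m + n)) (of_int (n - m)) + Poly_Mapping.single C1 (coc m n)"
  "basis_bracket (L m) (W n) = Poly_Mapping.single (W (m + n)) (of_int (n - m)) + Poly_Mapping.single C2 (coc m n)"
  "basis_bracket (W n) (L m) = Poly_Mapping.single (W (m + n)) (of_int (m - n)) + Poly_Mapping.single C2 (- coc m n)"
  "basis_bracket (L m) (G k) = Poly_Mapping.single (G (m + k)) (half k - of_int m / 2)"
  "basis_bracket (G k) (L m) = Poly_Mapping.single (G (m + k)) (- (half k - of_int m / 2))"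
  "basis_bracket (G j) (G k) = Poly_Mapping.single (W (j + k + 1)) 2 + Poly_Mapping.single C2 (gcoc j k)"
  "basis_bracket (W m) (W n) = 0"
  "basis_bracket (W m) (G k) = 0"
  "basis_bracket (G k) (W m) = 0"
  "basis_bracket C1 a = 0" "basis_bracket C2 a = 0"
  "basis_bracket a C1 = 0" "basis_bracket a C2 = 0"
  by (simp_all add: basis_bracket.simps coc_def gcoc_def minus_diff_eq flip: single_uminus)

lemma basis_bracket_graded: "basis_bracket a b \<in> bms_part (parity a + parity b)"
  by (cases a; cases b)
    (auto simp: bb_simps
      intro!: bms.subspace_add[OF bms_part_subspace] single_in_part
      bms.subspace_0[OF bms_part_subspace])

lemma basis_skew: "basis_bracket a b = - bms_scale (super_sign (parity a) (parity b)) (basis_bracket b a)"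
proof -
  note s = super_sign_def bb_simps bms_scale_single bms.scale_right_distrib
  have LL: "basis_bracket (L m) (L n) = - basis_bracket (L n) (L m)" for m n
    by (simp add: bb_simps coc_skew[of m n] add.commute[of m n] flip: single_uminus)
  have LW: "basis_bracket (L m) (W n) = - basis_bracket (W n) (L m)" for m n
    by (simp add: bb_simps flip: single_uminus)
  have LG: "basis_bracket (L m) (G n) = - basis_bracket (G n) (L m)" for m n
    by (simp add: bb_simps flip: single_uminus)
  have GG: "basis_bracket (G m) (G n) = basis_bracket (G n) (G m)" for m n
    by (simp add: bb_simps gcoc_sym[of m n] add.commute[of m n])
  have m1: "bms_scale (- 1) x = - x" for x by simp
  show ?thesis
    by (cases a; cases b) (simp_all add: super_sign_def LW LG bb_simps(7-13), (rule LL GG)+)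
qed

lemma basis_jacobi:
  "bms_bracket (Poly_Mapping.single a 1) (basis_bracket b c) =
     bms_bracket (basis_bracket a b) (Poly_Mapping.single c 1) +
     bms_scale (super_sign (parity a) (parity b))
       (bms_bracket (Poly_Mapping.single b 1) (basis_bracket a c))"
proof -
  note s = super_sign_def br_simps bms_bracket_single bb_simps bms_scale_single bms.scale_right_distrib
  have H: "Poly_Mapping.single x a + Poly_Mapping.single C b =
      Poly_Mapping.single x' a' + Poly_Mapping.single C b' + (Poly_Mapping.single x'' a'' + Poly_Mapping.single C b'')"
    if "x' = x" "x'' = x" "a = a' + a''" "b = b' + b''"
    for x x' x'' C :: bms_basis and a b a' b' a'' b'' :: complex
    using that by (simp add: single_add add_ac)
  have H2: "Poly_Mapping.single x a =
      Poly_Mapping.single x' a' + Poly_Mapping.single x'' a''"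
    if "x' = x" "x'' = x" "a = a' + a''"
    for x x' x'' :: bms_basis and a a' a'' :: complex
    using that by (simp add: single_add)
  have J: "of_int (p - n) * coc m (n + p) - of_int (n - m) * coc (m + n) p - of_int (p - m) * coc n (m + p) = 0" for m n p
    using coc_jacobi[of p n m] by simp
  have GJ: "2 * coc m (j + k + 1) - (half j - of_int m / 2) * gcoc (m + j) k - (half k - of_int m / 2) * gcoc j (m + k) = 0" for m j k
    using gcoc_jacobi[of m j k] by simp
  show ?thesis
    apply (cases a; cases b; cases c; simp add: s)
    subgoal for m n p using J[of p n m]
      by (intro H) (simp_all add: algebra_simps)
    subgoal for m n p using J[of p n m]
      by (intro H) (simp_all add: algebra_simps)
    subgoal for m n p
      by (intro H2) (simp_all add: half_def field_simps)
    subgoal for m n p using J[of n p m] coc_skew[of "m + p" n]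
      by (intro H) (simp_all add: half_def field_simps)
    subgoal for m n p
      by (intro H2) (simp_all add: half_def field_simps)
    subgoal for m n p using GJ[of m n p]
      by (intro H) (simp_all add: half_def field_simps)
    subgoal for m n p using J[of m p n] coc_skew[of "n + p" m] coc_skew[of n p]
      by (intro H) (simp_all add: half_def field_simps)
    subgoal for m n p
      by (intro H2) (simp_all add: half_def field_simps)
    subgoal for m n p using gcoc_jacobi[of n m p]
      by (intro H; (simp add: algebra_simps; fail | simp add: half_def field_simps))
    subgoal for m n p using gcoc_jacobi[of p m n] gcoc_sym[of n "p + m"]
      by (intro H; (simp add: algebra_simps; fail | simp add: half_def field_simps))
    done
qed

lemma lie_superalgebra_bms: "lie_superalgebra bms_scale bms_part bms_bracket"
proof -
  interpret bs: super_vector_space bms_scale bms_part by (rule bms_super_vector_space)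
  show ?thesis
  proof unfold_locales
    show "bms_bracket x y \<in> bms_part (i + j)" if "x \<in> bms_part i" "y \<in> bms_part j" for x y i j
      unfolding bms_bracket_def using that basis_bracket_graded
      by (intro bms.subspace_sum bms.subspace_scale bms_part_subspace) (auto simp: bms_part_def)
    show "bms_bracket x y = - bms_scale (super_sign i j) (bms_bracket y x)"
      if "x \<in> bms_part i" "y \<in> bms_part j" for x y i j
      using that(1)
    proof (induction rule: bms_part_induct)
      case (basis a c)
      from that(2) show ?case
      proof (induction rule: bms_part_induct)
        case (basis b d)
        then show ?case using basis_skew[of a b] \<open>parity a = i\<close>
          by (simp add: br_simps bms_bracket_single mult_ac)
      qed (simp_all add: br_simps bms.scale_right_distrib)
    qed (simp_all add: br_simps bms.scale_right_distrib)
    show "bms_bracket x (bms_bracket y z) = bms_bracket (bms_bracket x y) z +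
        bms_scale (super_sign i j) (bms_bracket y (bms_bracket x z))"
      if "x \<in> bms_part i" "y \<in> bms_part j" "z \<in> bms_part k" for x y z i j k
      using that(1)
    proof (induction rule: bms_part_induct)
      case (basis a c)
      from that(2) show ?case
      proof (induction rule: bms_part_induct)
        case (basis b d)
        from that(3) show ?case
        proof (induction rule: bms_part_induct)
          case (basis e f)
          then show ?case using basis_jacobi[of a b e] \<open>parity a = i\<close> \<open>parity b = j\<close>
            by (simp add: br_simps bms_bracket_single mult_ac bms.scale_right_distrib)
        qed (simp_all add: br_simps bms.scale_right_distrib)
      qed (simp_all add: br_simps bms.scale_right_distrib)
    qed (simp_all add: br_simps bms.scale_right_distrib)
  qed
qed

lemma shift_add: "shift c (f + g) = shift c f + shift c g"
  by (simp add: shift_def pcompose_add)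
lemma shift_diff: "shift c (f - g) = shift c f - shift c g"
  by (simp add: shift_def pcompose_diff)
lemma shift_mult: "shift c (f * g) = shift c f * shift c g"
  by (simp add: shift_def pcompose_mult)
lemma shift_const: "shift c [:p:] = [:p:]"
  by (simp add: shift_def)
lemma shift_0: "shift c 0 = 0"
  by (simp add: shift_def)
lemma shift_svar: "shift c svar = svar - [:[:c:]:]"
  by (simp add: shift_def svar_def pcompose_pCons)
lemma shift_shift: "shift c (shift d f) = shift (c + d) f"
proof -
  have "shift c (shift d f) = pcompose f (pcompose [:[:- d:], 1:] [:[:- c:], 1:])"
    by (simp add: shift_def pcompose_assoc)
  also have "pcompose [:[:- d:], 1:] [:[:- c:], 1:] = [:[:- (c + d):], 1 :: complex poly:]"
    by (simp add: pcompose_pCons)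
  finally show ?thesis by (simp add: shift_def)
qed

lemma coeff_dt: "poly.coeff (dt f) n = pderiv (poly.coeff f n)"
  by (simp add: dt_def coeff_map_poly)
lemma dt_add: "dt (f + g) = dt f + dt g"
  by (rule poly_eqI) (simp add: coeff_dt pderiv_add)
lemma dt_diff: "dt (f - g) = dt f - dt g"
  by (rule poly_eqI) (simp add: coeff_dt pderiv_diff)
lemma dt_0: "dt 0 = 0"
  by (rule poly_eqI) (simp add: coeff_dt)
lemma dt_const: "dt [:p:] = [:pderiv p:]"
  by (rule poly_eqI) (simp add: coeff_dt coeff_pCons split: nat.splits)
lemma dt_smult: "dt (smult p f) = smult p (dt f) + smult (pderiv p) f"
  by (rule poly_eqI) (simp add: coeff_dt pderiv_mult)
lemma dt_mult: "dt (f * g) = f * dt g + dt f * g"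
proof (rule poly_eqI)
  fix n
  have "pderiv (\<Sum>i\<le>n. poly.coeff f i * poly.coeff g (n - i)) =
    (\<Sum>i\<le>n. pderiv (poly.coeff f i * poly.coeff g (n - i)))"
    by (rule higher_pderiv_sum[where n = 1, simplified])
  then show "poly.coeff (dt (f * g)) n = poly.coeff (f * dt g + dt f * g) n"
    by (simp add: coeff_dt coeff_mult pderiv_mult sum.distrib mult.commute[of "poly.coeff g _" "pderiv _"])
qed
lemma dt_svar: "dt svar = 0"
  by (rule poly_eqI) (simp add: coeff_dt svar_def coeff_pCons split: nat.splits)
lemma dt_shift: "dt (shift c f) = shift c (dt f)"
proof (induction f)
  case 0
  then show ?case by (simp add: shift_0 dt_0)
next
  case (pCons a f)
  have 1: "pCons a f = [:a:] + svar * f" by (simp add: svar_def)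
  have 2: "dt [:[:c:]:] = 0" by (simp add: dt_const)
  show ?case unfolding 1
    by (simp add: shift_add shift_mult shift_const shift_svar dt_add dt_mult dt_diff dt_svar dt_const 2 pCons.IH)
qed

definition cst :: "complex \<Rightarrow> complex poly poly" where "cst c = [:[:c:]:]"
definition tvar :: "complex poly poly" where "tvar = [:[:0, 1:]:]"

lemma cst_add: "cst (a + b) = cst a + cst b" and cst_diff: "cst (a - b) = cst a - cst b"
  and cst_mult: "cst (a * b) = cst a * cst b" and cst_uminus: "cst (- a) = - cst a"
  and cst_0: "cst 0 = 0" and cst_1: "cst 1 = 1" and cst_numeral: "cst (numeral n) = numeral n"
  by (simp_all add: cst_def numeral_poly flip: one_pCons)

lemma dt_cst: "dt (cst c) = 0" and dt_tvar: "dt tvar = 1"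
  and shift_cst: "shift d (cst c) = cst c" and shift_tvar: "shift d tvar = tvar"
  by (simp_all add: cst_def tvar_def dt_const shift_const pderiv_pCons flip: one_pCons)

lemma shift_numeral: "shift c (numeral n) = numeral n" and dt_numeral: "dt (numeral n) = 0"
  using shift_cst[of c "numeral n"] dt_cst[of "numeral n"] by (simp_all add: cst_numeral)

definition hq :: "complex \<Rightarrow> complex poly \<Rightarrow> complex poly" where
  "hq \<alpha> h = (h - [:poly h \<alpha>:]) div [:- \<alpha>, 1:]"

lemma hpoly_eq: "[:hpoly \<alpha> h m:] = cst (of_int m) * (cst (poly h \<alpha>) + (tvar - cst \<alpha>) * [:hq \<alpha> h:])
    - cst (of_int m * (of_int m - 1) * \<alpha>) * [:hq \<alpha> h:]"
proof -
  have "[:- \<alpha>, 1:] dvd h - [:poly h \<alpha>:]"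
    by (subst dvd_iff_poly_eq_0) simp
  then have "[:- \<alpha>, 1:] * hq \<alpha> h = h - [:poly h \<alpha>:]"
    unfolding hq_def by (rule dvd_mult_div_cancel)
  then have h: "h = [:poly h \<alpha>:] + [:- \<alpha>, 1:] * hq \<alpha> h" by (metis add.commute diff_add_cancel)
  have t: "tvar - cst \<alpha> = [:[:- \<alpha>, 1:]:]" by (simp add: tvar_def cst_def)
  have "hpoly \<alpha> h m = smult (of_int m) ([:poly h \<alpha>:] + [:- \<alpha>, 1:] * hq \<alpha> h)
      - smult (of_int (m * (m - 1)) * \<alpha>) (hq \<alpha> h)"
    unfolding hpoly_def hq_def[symmetric] h[symmetric] ..
  then show ?thesis unfolding t by (simp add: cst_def)
qed

lemma smult_conv: "smult p f = [:p:] * f" by simp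

lemma lin_conv: "[:[:c, 1:]:] = tvar + cst c" by (simp add: tvar_def cst_def)
lemma smult_lin: "[:smult c p:] = cst c * [:p:]" by (simp add: cst_def)

lemmas pushes = shift_numeral dt_numeral shift_add shift_diff shift_mult shift_cst shift_tvar shift_svar[folded cst_def] shift_shift shift_const shift_0
  dt_add dt_diff dt_mult dt_cst dt_tvar dt_svar dt_shift[symmetric] dt_const dt_0

lemma act_L: "basis_act lam \<alpha> h (L m) (f, k) =
   (cst (lam powi m) * ((svar + [:hpoly \<alpha> h m:]) * shift (of_int m) f
       - cst (of_int m) * (tvar - cst (of_int m) * cst \<alpha>) * dt (shift (of_int m) f)),
    cst (lam powi m) * ((svar - cst (1/2) * cst (of_int m) + [:hpoly \<alpha> h m:]) * shift (of_int m) k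
       - cst (of_int m) * (tvar - cst (of_int m) * cst \<alpha>) * dt (shift (of_int m) k)))"
proof -
  have "[:[:of_int m / 2:]:] = cst (1/2) * cst (of_int m)" by (simp add: cst_def)
  then show ?thesis
  unfolding basis_act.simps smult_conv[of "[:lam powi m:]"] smult_conv[of "smult _ _"] smult_lin lin_conv cst_def[symmetric]
  by (simp add: cst_mult cst_uminus algebra_simps)
qed

lemma act_W: "basis_act lam \<alpha> h (W m) (f, k) =
   (cst (lam powi m) * (tvar - cst (of_int m) * cst \<alpha>) * shift (of_int m) f,
    cst (lam powi m) * (tvar - cst (of_int m) * cst \<alpha>) * shift (of_int m) k)"
  unfolding basis_act.simps smult_conv[of "smult _ _"] smult_lin lin_conv
  by (simp add: cst_mult cst_uminus)

lemma act_G: "basis_act lam \<alpha> h (G j) (f, k) =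
   (cst (lam powi (j + 1)) * (tvar - 2 * cst (half j) * cst \<alpha>) * shift (half j) k,
    cst (lam powi j) * shift (half j) f)"
  unfolding basis_act.simps smult_conv[of "smult _ _"] smult_lin lin_conv smult_conv[of "[:lam powi j:]"] cst_def[symmetric]
  by (simp add: cst_mult cst_uminus cst_numeral)

lemma act_zero_C: "basis_act lam \<alpha> h C1 v = 0" "basis_act lam \<alpha> h C2 v = 0"
  by simp_all

declare basis_act.simps [simp del]

lemma powi_add: "lam \<noteq> 0 \<Longrightarrow> cst (lam powi (m + n)) = cst (lam powi m) * cst (lam powi n)"
  by (simp add: power_int_add cst_mult)

lemma omega_act_linear_left: "Vector_Spaces.linear bms_scale omega_scale (\<lambda>x. omega_act lam \<alpha> h x v)"
  using ext_linear[OF omega.vector_space_axioms] unfolding omega_act_def .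

interpretation oal: Vector_Spaces.linear bms_scale omega_scale "\<lambda>x. omega_act lam \<alpha> h x v" for lam \<alpha> h v
  by (rule omega_act_linear_left)

lemma omega_act_single:
  "omega_act lam \<alpha> h (Poly_Mapping.single a c) v = omega_scale c (basis_act lam \<alpha> h a v)"
  by (simp add: omega_act_def)

lemma omega_scale_Pair: "omega_scale c (x, y) = (cst c * x, cst c * y)"
  by (simp add: omega_scale_def cst_def)

lemma two_cst_half: "2 * (cst (1/2) * x) = x"
  using cst_mult[of 2 "1/2"] by (simp add: cst_1 cst_numeral flip: mult.assoc)

lemma two_cst_half': "cst (1/2) * (2 * x) = x"
  using two_cst_half[of x] by (simp add: mult_ac)

lemma basis_comm:
  assumes "lam \<noteq> 0"
  shows "basis_act lam \<alpha> h a (basis_act lam \<alpha> h b v) -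
      omega_scale (super_sign (parity a) (parity b)) (basis_act lam \<alpha> h b (basis_act lam \<alpha> h a v))
   = omega_act lam \<alpha> h (basis_bracket a b) v"
proof -
  obtain f k where v: "v = (f, k)" by (cases v)
  define q where "q = [:hq \<alpha> h:]"
  have q': "shift c q = q" for c by (simp add: q_def shift_const)
  have zero: "basis_act lam \<alpha> h a 0 = 0" for a
    by (cases a) (simp_all add: zero_prod_def act_L act_W act_G act_zero_C shift_0 dt_0)
  have h: "half m = of_int m + 1 / 2" for m by (simp add: half_def)
  have d2: "of_int m / 2 = (1/2) * (of_int m :: complex)" for m by simp
  have ho: "half m + half n = of_int (m + n + 1)" for m n by (simp add: half_def)
  have hl: "of_int m + half n = half (m + n)" "half n + of_int m = half (m + n)" for m n by (simp_all add: half_def)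
  have 1: "cst (half n) = cst (of_int n) + cst (1/2)" for n
    by (simp add: half_def cst_add)
  have po: "lam powi 1 = lam" by simp
  note u = basis_bracket.simps if_distrib[of "\<lambda>x. omega_act lam \<alpha> h x (f, k)"] oal.add oal.neg oal.zero
    omega_act_single act_zero_C omega.scale_zero_right if_cancel add_0_right super_sign_def parity.simps bb_simps(7-13)
    if_True if_False simp_thms zero_neq_one omega.scale_one minus_zero omega.scale_minus_left diff_minus_eq_add
    zero diff_zero diff_self
  note w = act_L act_W act_G hpoly_eq q_def[symmetric] omega_scale_Pair minus_prod_def plus_prod_def zero_prod_def uminus_prod_def
    fst_conv snd_conv powi_add[OF assms]
      pushes q' shift_cst ho hl
  note w2 = d2 1 of_int_add of_int_diff of_int_1 cst_add cst_diff cst_mult cst_1 cst_numeral cst_0 cst_uminus po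
  have LL: ?thesis if "a = L m" "b = L n" for m n
    unfolding v that by (simp only: u, (simp only: w)?, (simp only: w2)?)
      (simp add: algebra_simps)
  have LW: ?thesis if "a = L m" "b = W n" for m n
    unfolding v that by (simp only: u, (simp only: w)?, (simp only: w2)?)
      (simp add: algebra_simps)
  have WL: ?thesis if "a = W m" "b = L n" for m n
    unfolding v that by (simp only: u, (simp only: w)?, (simp only: w2)?)
      (simp add: algebra_simps)
  have WW: ?thesis if "a = W m" "b = W n" for m n
    unfolding v that by (simp only: u, (simp only: w)?, (simp only: w2)?)
      (simp add: algebra_simps)
  have WG: ?thesis if "a = W m" "b = G n" for m n
    unfolding v that by (simp only: u, (simp only: w)?, (simp only: w2)?)
      (simp add: algebra_simps)
  have GW: ?thesis if "a = G m" "b = W n" for m n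
    unfolding v that by (simp only: u, (simp only: w)?, (simp only: w2)?)
      (simp add: algebra_simps)
  have GG: ?thesis if "a = G m" "b = G n" for m n
    unfolding v that by (simp only: u, (simp only: w)?, (simp only: w2)?)
      (simp add: algebra_simps two_cst_half[of 1, simplified])
  note w3 = d2 of_int_add of_int_diff of_int_1 cst_add cst_diff cst_mult cst_1 cst_numeral cst_0 cst_uminus po
  have LG: ?thesis if "a = L m" "b = G n" for m n
  proof -
    define M where "M = cst (1 / 2) * cst (of_int m)"
    have cm: "cst (of_int m) = 2 * M" by (simp add: M_def two_cst_half)
    have hh: "cst (half (m + n)) = cst (of_int m) + cst (half n)" by (simp add: half_def cst_add add_ac)
    have hh2: "cst (half (n + m)) = cst (of_int m) + cst (half n)" by (simp add: half_def cst_add add_ac)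
    show ?thesis
      unfolding v that by (simp only: u, (simp only: w)?, (simp only: w3 hh hh2)?, (simp only: M_def[symmetric])?, simp only: cm)
       (simp add: algebra_simps)
  qed
  have GL: ?thesis if "a = G m" "b = L n" for m n
  proof -
    define M where "M = cst (1 / 2) * cst (of_int n)"
    have cm: "cst (of_int n) = 2 * M" by (simp add: M_def two_cst_half)
    have hh: "cst (half (m + n)) = cst (of_int n) + cst (half m)" by (simp add: half_def cst_add add_ac)
    have hh2: "cst (half (n + m)) = cst (of_int n) + cst (half m)" by (simp add: half_def cst_add add_ac)
    show ?thesis
      unfolding v that by (simp only: u, (simp only: w)?, (simp only: w3 hh hh2)?, (simp only: M_def[symmetric])?, simp only: cm)
       (simp add: algebra_simps)
  qed
  have C: ?thesis if "a = C1 \<or> a = C2 \<or> b = C1 \<or> b = C2"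
    using that by (auto simp: bb_simps act_zero_C zero oal.zero)
  show ?thesis using LL LW LG WL WW WG GL GW GG C by (cases a; cases b) simp_all
qed

lemma basis_act_linear: "Vector_Spaces.linear omega_scale omega_scale (basis_act lam \<alpha> h a)"
proof unfold_locales
  fix v w :: omega_space
  obtain f k f' k' where vw: "v = (f, k)" "w = (f', k')" by (metis surj_pair)
  show "basis_act lam \<alpha> h a (v + w) = basis_act lam \<alpha> h a v + basis_act lam \<alpha> h a w"
    unfolding vw plus_prod_def fst_conv snd_conv
    by (cases a) (simp_all add: act_L act_W act_G act_zero_C shift_add dt_add algebra_simps zero_prod_def)
next
  fix c and v :: omega_space
  obtain f k where v: "v = (f, k)" by (metis surj_pair)
  show "basis_act lam \<alpha> h a (omega_scale c v) = omega_scale c (basis_act lam \<alpha> h a v)"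
    unfolding v omega_scale_Pair
    by (cases a) (simp_all add: act_L act_W act_G act_zero_C shift_mult shift_cst dt_mult dt_cst algebra_simps omega_scale_Pair zero_prod_def)
qed

lemma omega_act_linear_right: "Vector_Spaces.linear omega_scale omega_scale (omega_act lam \<alpha> h x)"
proof unfold_locales
  interpret b: Vector_Spaces.linear omega_scale omega_scale "basis_act lam \<alpha> h a" for a
    by (rule basis_act_linear)
  show "omega_act lam \<alpha> h x (v + w) = omega_act lam \<alpha> h x v + omega_act lam \<alpha> h x w" for v w
    by (simp add: omega_act_def b.add omega.scale_right_distrib sum.distrib)
  show "omega_act lam \<alpha> h x (omega_scale c v) = omega_scale c (omega_act lam \<alpha> h x v)" for c v
    by (simp add: omega_act_def b.scale omega.scale_sum_right mult.commute)
qed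

interpretation oar: Vector_Spaces.linear omega_scale omega_scale "omega_act lam \<alpha> h x" for lam \<alpha> h x
  by (rule omega_act_linear_right)

lemma omega_part_subspace: "omega.subspace (omega_part i)"
  by (auto simp: omega.subspace_def omega_part_def omega_scale_def)

lemma omega_super_vector_space: "super_vector_space omega_scale omega_part"
proof unfold_locales
  show "omega_part 0 \<inter> omega_part 1 = {0}"
    by (auto simp: omega_part_def prod_eq_iff)
  show "\<exists>u\<in>omega_part 0. \<exists>w\<in>omega_part 1. v = u + w" for v
    by (rule bexI[of _ "(fst v, 0)"], rule bexI[of _ "(0, snd v)"]) (simp_all add: omega_part_def)
qed (rule omega_part_subspace)

lemma basis_act_graded: "v \<in> omega_part j \<Longrightarrow> basis_act lam \<alpha> h a v \<in> omega_part (parity a + j)"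
  by (cases v; cases a; cases j)
    (auto simp: omega_part_def act_L act_W act_G act_zero_C shift_0 dt_0)

theorem lie_supermodule_omega:
  assumes "lam \<noteq> 0"
  shows "lie_supermodule bms_scale bms_part bms_bracket omega_scale omega_part (omega_act lam \<alpha> h)"
proof -
  interpret g: lie_superalgebra bms_scale bms_part bms_bracket by (rule lie_superalgebra_bms)
  interpret m: super_vector_space omega_scale omega_part by (rule omega_super_vector_space)
  show ?thesis
  proof unfold_locales
    show "omega_act lam \<alpha> h x v \<in> omega_part (i + j)" if "x \<in> bms_part i" "v \<in> omega_part j" for x v i j
      unfolding omega_act_def
    proof (intro omega.subspace_sum omega.subspace_scale omega_part_subspace)
      fix a assume "a \<in> Poly_Mapping.keys x"
      then have "parity a = i" using that by (simp add: bms_part_def)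
      then show "basis_act lam \<alpha> h a v \<in> omega_part (i + j)"
        using basis_act_graded[OF that(2)] by metis
    qed
    show "omega_act lam \<alpha> h x (omega_act lam \<alpha> h y v) -
        omega_scale (super_sign i j) (omega_act lam \<alpha> h y (omega_act lam \<alpha> h x v)) =
        omega_act lam \<alpha> h (bms_bracket x y) v"
      if "x \<in> bms_part i" "y \<in> bms_part j" for x y v i j
      using that(1)
    proof (induction rule: bms_part_induct)
      case (basis a c)
      from that(2) show ?case
      proof (induction rule: bms_part_induct)
        case (basis b d)
        then show ?case using basis_comm[OF assms, of \<alpha> h a b v, symmetric] \<open>parity a = i\<close>
          by (simp add: br_simps bms_bracket_single omega_act_single oal.scale oar.scale
              omega.scale_right_diff_distrib mult_ac)
      qed (simp_all add: br_simps oal.add oal.zero oar.add oar.zero omega.scale_right_distrib algebra_simps)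
    qed (simp_all add: br_simps oal.add oal.zero oar.add oar.zero omega.scale_right_distrib algebra_simps)
  qed
qed

end

theory Submission
  imports Defs
begin

text \<open>
  Let \<open>\<alpha> \<noteq> 0\<close> and let \<open>N\<close> be a graded submodule with even part \<open>I\<close>. On an even \<open>f\<close> the
  composite \<open>G\<^sub>r G\<^sub>q\<close> is, up to a power of \<open>lam\<close>, the map
  \<open>f(t,s) \<mapsto> (t - 2 r \<alpha>) f(t, s - (r + q))\<close>: the shift depends on \<open>r + q\<close> only, while the factor
  depends on \<open>r\<close>. Comparing two decompositions of the same integer \<open>n = r + q\<close> yields
  \<open>2 \<alpha> f(t, s - n) \<in> I\<close>, so \<open>I\<close> is closed under integer shifts of \<open>s\<close>, and then under
  multiplication by \<open>t\<close>. As \<open>L\<^sub>0\<close> is multiplication by \<open>s\<close>, the set \<open>I\<close> is an ideal of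
  \<open>\<complex>[t,s]\<close> (\<open>even_part_ideal\<close>). Modulo this ideal, \<open>L\<^sub>1\<close> and \<open>L\<^sub>-\<^sub>1\<close> act on suitably
  shifted elements as multiples of \<open>(t - \<alpha>) \<partial>/\<partial>t\<close> and \<open>(t + \<alpha>) \<partial>/\<partial>t\<close>, so \<open>I\<close> is
  closed under \<open>\<partial>/\<partial>t\<close> as well (\<open>even_part_dt\<close>).

  A nonzero ideal with these two closure properties is everything: in characteristic zero,
  \<open>f(t,s) - f(t,s - 1)\<close> lowers the degree in \<open>s\<close> of a nonconstant polynomial by one, and
  \<open>\<partial>/\<partial>t\<close> does the same for \<open>t\<close>, so one reaches a nonzero constant
  (\<open>shift_dt_ideal_one\<close>). The operators \<open>G\<^sub>r\<close> are injective, so a nonzero \<open>N\<close> has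
  \<open>I \<noteq> 0\<close>, and they map the even part onto the odd part, so \<open>I = \<complex>[t,s]\<close> forces \<open>N\<close> to be the
  whole module.

  If \<open>\<alpha> = 0\<close>, every operator preserves divisibility by the inner variable: the derivative occurs
  only in the combination \<open>t \<partial>/\<partial>t\<close>. Hence the pairs with both entries divisible by that
  variable form a proper nonzero submodule.
\<close>

section \<open>Differential-difference ideals of bivariate polynomials\<close>

lemma shift_zero: "shift 0 f = f"
  by (simp add: shift_def pcompose_idR)

lemma degree_diff_shift_less:
  assumes "degree f > 0"
  shows "degree (f - shift c f) < degree f"
proof -
  have deg: "degree (shift c f) = degree f"
    by (simp add: shift_def degree_pcompose)
  have lead: "coeff (shift c f) (degree f) = coeff f (degree f)"
    using lead_coeff_comp[of "[:[:- c:], 1:]" f] deg by (simp add: shift_def)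
  show ?thesis
  proof (rule degree_lessI)
    show "f - shift c f \<noteq> 0 \<or> degree f > 0" using assms by simp
    show "\<forall>k\<ge>degree f. coeff (f - shift c f) k = 0"
    proof (intro allI impI)
      fix k assume "degree f \<le> k"
      then show "coeff (f - shift c f) k = 0"
        using lead deg by (cases "k = degree f") (simp_all add: coeff_eq_0)
    qed
  qed
qed

text \<open>A polynomial in \<open>s\<close> with period 1 takes the value \<open>f(t,0)\<close> at all natural numbers, hence
  minus this value has infinitely many roots.\<close>

lemma shift_one_fixed_imp_const:
  assumes "shift 1 f = f"
  shows "degree f = 0"
proof -
  have minus_one: "[:- 1:] = (- 1 :: complex poly)" by (simp add: one_pCons)
  have per: "poly f x = poly f (x - 1)" for x
  proof -
    have "poly f x = poly (shift 1 f) x" by (simp add: assms)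
    also have "\<dots> = poly f (x - 1)"
      by (simp add: shift_def poly_pcompose minus_one algebra_simps)
    finally show ?thesis .
  qed
  have val: "poly f (of_nat n) = poly f 0" for n
  proof (induction n)
    case (Suc n)
    then show ?case using per[of "of_nat (Suc n)"] by simp
  qed simp
  have "range of_nat \<subseteq> {x. poly (f - [:poly f 0:]) x = 0}"
    by (auto simp: val)
  moreover have "infinite (range (of_nat :: nat \<Rightarrow> complex poly))"
    by (rule range_inj_infinite) (simp add: inj_on_def)
  ultimately have "infinite {x. poly (f - [:poly f 0:]) x = 0}"
    using finite_subset by blast
  then have "f = [:poly f 0:]"
    using poly_roots_finite[of "f - [:poly f 0:]"] by auto
  then show ?thesis by (metis degree_pCons_0)
qed

text \<open>Both minimal-degree arguments apply the degree-lowering operator to an element of least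
  degree: it can be neither nonzero, by minimality, nor zero, unless the degree is already 0.\<close>

lemma shift_dt_ideal_one:
  assumes add: "\<And>f g. f \<in> I \<Longrightarrow> g \<in> I \<Longrightarrow> f + g \<in> I"
    and mult: "\<And>f g. f \<in> I \<Longrightarrow> g * f \<in> I"
    and dt: "\<And>f. f \<in> I \<Longrightarrow> dt f \<in> I"
    and shift: "\<And>f. f \<in> I \<Longrightarrow> shift 1 f \<in> I"
    and nonzero: "f \<in> I" "f \<noteq> 0"
  shows "1 \<in> I"
proof -
  obtain g where g: "g \<in> I" "g \<noteq> 0"
    and g_min: "\<And>g'. g' \<in> I \<Longrightarrow> g' \<noteq> 0 \<Longrightarrow> degree g \<le> degree g'"
    using ex_has_least_nat[of "\<lambda>g. g \<in> I \<and> g \<noteq> 0" f degree] nonzero by blast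
  have "degree g = 0"
  proof (rule ccontr)
    assume pos: "degree g \<noteq> 0"
    then have ne: "g - shift 1 g \<noteq> 0" using shift_one_fixed_imp_const[of g] by auto
    have "g - shift 1 g = g + (- 1) * shift 1 g" by simp
    also have "\<dots> \<in> I" by (intro add mult shift g)
    finally show False using g_min ne degree_diff_shift_less[of g 1] pos by fastforce
  qed
  then obtain p where "g = [:p:]" by (rule degree_eq_zeroE)
  with g have p: "[:p:] \<in> I" "p \<noteq> 0" by auto
  obtain q where q: "[:q:] \<in> I" "q \<noteq> 0"
    and q_min: "\<And>q'. [:q':] \<in> I \<Longrightarrow> q' \<noteq> 0 \<Longrightarrow> degree q \<le> degree q'"
    using ex_has_least_nat[of "\<lambda>q. [:q:] \<in> I \<and> q \<noteq> 0" p degree] p by blast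
  have "degree q = 0"
  proof (rule ccontr)
    assume pos: "degree q \<noteq> 0"
    then have "pderiv q \<noteq> 0" by (simp add: pderiv_eq_0_iff)
    moreover have "[:pderiv q:] \<in> I" using dt[OF q(1)] by (simp add: dt_const)
    ultimately show False using q_min[of "pderiv q"] pos by (simp add: degree_pderiv)
  qed
  then obtain c where "q = [:c:]" by (rule degree_eq_zeroE)
  with q have c: "cst c \<in> I" "c \<noteq> 0" by (auto simp: cst_def)
  have "cst (inverse c) * cst c = 1" using c(2) by (simp add: cst_1 flip: cst_mult)
  with mult[OF c(1), of "cst (inverse c)"] show ?thesis by simp
qed

text \<open>Multiplication by constants, by \<open>t\<close> and by \<open>s\<close> generates multiplication by every
  polynomial.\<close>

lemma mult_closed_of_generators:
  assumes zero: "0 \<in> I" and add: "\<And>f g. f \<in> I \<Longrightarrow> g \<in> I \<Longrightarrow> f + g \<in> I"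
    and cst: "\<And>c f. f \<in> I \<Longrightarrow> cst c * f \<in> I"
    and tvar: "\<And>f. f \<in> I \<Longrightarrow> tvar * f \<in> I"
    and svar: "\<And>f. f \<in> I \<Longrightarrow> svar * f \<in> I"
    and f: "f \<in> I"
  shows "g * f \<in> I"
proof -
  have inner: "[:p:] * f \<in> I" for p
  proof (induction p)
    case 0
    show ?case using zero by simp
  next
    case (pCons c p)
    have "[:pCons c p:] = cst c + tvar * [:p:]" by (simp add: cst_def tvar_def)
    then have "[:pCons c p:] * f = cst c * f + tvar * ([:p:] * f)"
      by (simp only: distrib_right mult.assoc)
    then show ?case using add[OF cst[OF f] tvar[OF pCons.IH]] by simp
  qed
  show ?thesis
  proof (induction g)
    case 0
    show ?case using zero by simp
  next
    case (pCons p g)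
    have "pCons p g = [:p:] + svar * g" by (simp add: svar_def)
    then have "pCons p g * f = [:p:] * f + svar * (g * f)"
      by (simp only: distrib_right mult.assoc)
    then show ?case using add[OF inner svar[OF pCons.IH]] by simp
  qed
qed

section \<open>The even part of a submodule\<close>

lemma omega_act_basis: "omega_act lam \<alpha> h (Poly_Mapping.single a 1) v = basis_act lam \<alpha> h a v"
  by (simp add: omega_act_single)

lemma omega_act_closed:
  assumes "omega.subspace N" and "\<And>a. basis_act lam \<alpha> h a v \<in> N"
  shows "omega_act lam \<alpha> h x v \<in> N"
  unfolding omega_act_def using assms by (intro omega.subspace_sum omega.subspace_scale)

locale omega_submodule =
  fixes lam \<alpha> :: complex and h :: "complex poly" and N :: "omega_space set"
  assumes lam: "lam \<noteq> 0" and alpha: "\<alpha> \<noteq> 0"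
    and subspace: "omega.subspace N"
    and act: "v \<in> N \<Longrightarrow> basis_act lam \<alpha> h a v \<in> N"
begin

definition even_part :: "complex poly poly set" where
  "even_part = {f. (f, 0) \<in> N}"

lemma even_part_zero: "0 \<in> even_part"
  using omega.subspace_0[OF subspace] by (simp add: even_part_def zero_prod_def)

lemma even_part_add: "f \<in> even_part \<Longrightarrow> g \<in> even_part \<Longrightarrow> f + g \<in> even_part"
  using omega.subspace_add[OF subspace, of "(f, 0)" "(g, 0)"] by (simp add: even_part_def)

lemma even_part_cst: "f \<in> even_part \<Longrightarrow> cst c * f \<in> even_part"
  using omega.subspace_scale[OF subspace, of "(f, 0)" c]
  by (simp add: even_part_def omega_scale_Pair)

lemma even_part_diff: "f \<in> even_part \<Longrightarrow> g \<in> even_part \<Longrightarrow> f - g \<in> even_part"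
  using omega.subspace_diff[OF subspace, of "(f, 0)" "(g, 0)"] by (simp add: even_part_def)

lemma even_part_cst_cancel:
  assumes "cst c * f \<in> even_part" "c \<noteq> 0"
  shows "f \<in> even_part"
proof -
  have "cst (inverse c) * (cst c * f) = cst (inverse c * c) * f"
    by (simp only: cst_mult mult.assoc)
  also have "\<dots> = f" using assms(2) by (simp add: cst_1)
  finally show ?thesis using even_part_cst[OF assms(1), of "inverse c"] by (simp only:)
qed

text \<open>The index \<open>j\<close> of the inner operator is chosen such that the two half-integers add up to
  \<open>n\<close>, whatever \<open>i\<close> is.\<close>

lemma even_part_GG:
  assumes "f \<in> even_part"
  shows "(tvar - cst (2 * half i * \<alpha>)) * shift (of_int n) f \<in> even_part"
proof -
  define j where "j = n - 1 - i"
  have "basis_act lam \<alpha> h (G i) (basis_act lam \<alpha> h (G j) (f, 0)) \<in> N"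
    using assms by (intro act) (simp add: even_part_def)
  moreover have "half i + half j = of_int n" by (simp add: half_def j_def)
  moreover have "lam powi (i + 1) * lam powi j = lam powi n"
    using lam by (simp add: j_def flip: power_int_add)
  ultimately have "cst (lam powi n) * ((tvar - cst (2 * half i * \<alpha>)) * shift (of_int n) f)
      \<in> even_part"
    by (simp add: even_part_def act_G shift_0 shift_mult shift_cst shift_shift cst_numeral
        mult_ac cst_mult flip: \<open>lam powi (i + 1) * lam powi j = lam powi n\<close>)
  then show ?thesis by (rule even_part_cst_cancel) (simp add: lam)
qed

lemma even_part_shift:
  assumes "f \<in> even_part"
  shows "shift (of_int n) f \<in> even_part"
proof -
  have "cst (2 * \<alpha>) * shift (of_int n) f =
      (tvar - cst (2 * half (- 1) * \<alpha>)) * shift (of_int n) f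
      - (tvar - cst (2 * half 0 * \<alpha>)) * shift (of_int n) f"
    by (simp add: half_def algebra_simps cst_uminus cst_mult cst_numeral)
  also have "\<dots> \<in> even_part" by (intro even_part_diff even_part_GG assms)
  finally show ?thesis by (rule even_part_cst_cancel) (simp add: alpha)
qed

lemma even_part_tvar:
  assumes "f \<in> even_part"
  shows "tvar * f \<in> even_part"
proof -
  have "tvar * f = (tvar - cst (2 * half 0 * \<alpha>)) * shift (of_int 0) f + cst (2 * half 0 * \<alpha>) * f"
    by (simp add: shift_zero algebra_simps)
  also have "\<dots> \<in> even_part" by (intro even_part_add even_part_GG even_part_cst assms)
  finally show ?thesis .
qed

lemma even_part_L:
  assumes "f \<in> even_part"
  shows "(svar + [:hpoly \<alpha> h m:]) * shift (of_int m) f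
      - cst (of_int m) * (tvar - cst (of_int m * \<alpha>)) * dt (shift (of_int m) f) \<in> even_part"
proof -
  have "basis_act lam \<alpha> h (L m) (f, 0) \<in> N" using assms by (intro act) (simp add: even_part_def)
  then have "cst (lam powi m) * ((svar + [:hpoly \<alpha> h m:]) * shift (of_int m) f
      - cst (of_int m) * (tvar - cst (of_int m * \<alpha>)) * dt (shift (of_int m) f)) \<in> even_part"
    by (simp add: even_part_def act_L shift_0 dt_0 cst_mult)
  then show ?thesis by (rule even_part_cst_cancel) (simp add: lam)
qed

lemma even_part_svar: "f \<in> even_part \<Longrightarrow> svar * f \<in> even_part"
  using even_part_L[of f 0] by (simp add: hpoly_def shift_zero cst_0)

lemma even_part_ideal: "f \<in> even_part \<Longrightarrow> g * f \<in> even_part"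
  by (rule mult_closed_of_generators[where I = even_part, OF even_part_zero even_part_add
        even_part_cst even_part_tvar even_part_svar])

text \<open>Applying \<open>L\<^sub>m\<close> to \<open>f(t, s + m)\<close> undoes the shift, so that all values of \<open>m\<close> speak about
  the same derivative.\<close>

lemma even_part_L_dt:
  assumes "f \<in> even_part"
  shows "cst (of_int m) * (tvar - cst (of_int m * \<alpha>)) * dt f \<in> even_part"
proof -
  have undo: "shift (of_int m) (shift (of_int (- m)) f) = f"
    by (simp add: shift_shift shift_zero)
  have "cst (of_int m) * (tvar - cst (of_int m * \<alpha>)) * dt f =
      (svar + [:hpoly \<alpha> h m:]) * f
      - ((svar + [:hpoly \<alpha> h m:]) * f - cst (of_int m) * (tvar - cst (of_int m * \<alpha>)) * dt f)"
    by simp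
  also have "\<dots> \<in> even_part"
    by (intro even_part_diff even_part_ideal[OF assms]
        even_part_L[OF even_part_shift[OF assms, of "- m"], of m, unfolded undo])
  finally show ?thesis .
qed

lemma even_part_dt:
  assumes "f \<in> even_part"
  shows "dt f \<in> even_part"
proof -
  \<comment> \<open>The elements for \<open>m = 1\<close> and \<open>m = -1\<close> are \<open>(t - \<alpha>) \<partial>f/\<partial>t\<close> and \<open>-(t + \<alpha>) \<partial>f/\<partial>t\<close>.\<close>
  have "cst (- 2 * \<alpha>) * dt f = cst (of_int 1) * (tvar - cst (of_int 1 * \<alpha>)) * dt f
      + cst (of_int (- 1)) * (tvar - cst (of_int (- 1) * \<alpha>)) * dt f"
    by (simp add: algebra_simps cst_uminus cst_mult cst_numeral cst_1)
  also have "\<dots> \<in> even_part" by (intro even_part_add even_part_L_dt assms)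
  finally show ?thesis by (rule even_part_cst_cancel) (simp add: alpha)
qed

lemma even_part_UNIV:
  assumes "f \<in> even_part" "f \<noteq> 0"
  shows "even_part = UNIV"
proof -
  have "1 \<in> even_part"
  proof (rule shift_dt_ideal_one[where I = even_part])
    show "shift 1 g \<in> even_part" if "g \<in> even_part" for g
      using even_part_shift[OF that, of 1] by simp
  qed (fact even_part_add even_part_ideal even_part_dt assms)+
  then show ?thesis using even_part_ideal[of 1] by auto
qed

text \<open>An odd vector \<open>k(y,x)\<close> is the image under \<open>G\<^sub>1\<^sub>/\<^sub>2\<close> of the even vector \<open>k(t, s + 1/2)\<close>.\<close>

lemma UNIV_if_even_part_UNIV:
  assumes "even_part = UNIV"
  shows "N = UNIV"
proof -
  have even: "(f, 0) \<in> N" for f using assms by (auto simp: even_part_def)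
  have odd: "(0, k) \<in> N" for k
    using act[OF even[of "shift (- half 0) k"], of "G 0"]
    by (simp add: act_G shift_0 shift_shift shift_zero cst_1)
  have "(f, k) \<in> N" for f k
    using omega.subspace_add[OF subspace even[of f] odd[of k]] by simp
  then show ?thesis by auto
qed

lemma even_part_nonzero_if_odd:
  assumes "(0, k) \<in> N" "k \<noteq> 0"
  shows "\<exists>f. f \<in> even_part \<and> f \<noteq> 0"
proof -
  let ?f = "cst lam * (tvar - cst \<alpha>) * shift (1 / 2) k"
  have "basis_act lam \<alpha> h (G 0) (0, k) \<in> N" using assms by (intro act)
  then have "?f \<in> even_part"
    by (simp add: act_G shift_0 even_part_def half_def cst_mult[symmetric] mult.assoc[symmetric]
        cst_numeral[symmetric])
  moreover have "cst lam \<noteq> 0" using lam by (simp add: cst_def)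
  moreover have "tvar - cst \<alpha> \<noteq> 0" by (simp add: tvar_def cst_def)
  moreover have "shift (1 / 2) k \<noteq> 0" using assms(2) by (simp add: shift_def pcompose_eq_0_iff)
  ultimately show ?thesis by (intro exI[of _ ?f]) simp
qed

end

section \<open>Simplicity\<close>

lemma graded_submodule_trivial:
  assumes "lam \<noteq> 0" "\<alpha> \<noteq> 0"
    and sub: "lie_supermodule.graded_submodule omega_scale omega_part (omega_act lam \<alpha> h) N"
  shows "N = {0} \<or> N = UNIV"
proof -
  interpret M: lie_supermodule bms_scale bms_part bms_bracket omega_scale omega_part
    "omega_act lam \<alpha> h"
    using assms(1) by (rule lie_supermodule_omega)
  have sub: "omega.subspace N" "\<And>x v. v \<in> N \<Longrightarrow> omega_act lam \<alpha> h x v \<in> N"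
    "\<And>v. v \<in> N \<Longrightarrow> \<exists>u\<in>N \<inter> omega_part 0. \<exists>w\<in>N \<inter> omega_part 1. v = u + w"
    using sub by (auto simp: M.graded_submodule_def)
  interpret omega_submodule lam \<alpha> h N
    using assms(1,2) sub(1) sub(2)[of _ "Poly_Mapping.single _ 1"]
    by unfold_locales (auto simp: omega_act_basis)
  show ?thesis
  proof (cases "N = {0}")
    case False
    then obtain v where v: "v \<in> N" "v \<noteq> 0" using omega.subspace_0[OF sub(1)] by blast
    from sub(3)[OF v(1)] obtain f k where fk: "(f, 0) \<in> N" "(0, k) \<in> N" "v = (f, k)"
      by (auto simp: omega_part_def)
    have "\<exists>f. f \<in> even_part \<and> f \<noteq> 0"
    proof (cases "f = 0")
      case True
      with v(2) fk(3) have "k \<noteq> 0" by (auto simp: zero_prod_def)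
      with fk(2) show ?thesis by (rule even_part_nonzero_if_odd)
    next
      case False
      with fk(1) show ?thesis by (auto simp: even_part_def)
    qed
    then show ?thesis using even_part_UNIV UNIV_if_even_part_UNIV by blast
  qed simp
qed

lemma tvar_dvd_shift: "tvar dvd f \<Longrightarrow> tvar dvd shift c f"
  by (auto simp: dvd_def shift_mult shift_tvar)

definition tvar_multiples :: "omega_space set" where
  "tvar_multiples = {v. tvar dvd fst v \<and> tvar dvd snd v}"

lemma subspace_tvar_multiples: "omega.subspace tvar_multiples"
  by (auto simp: omega.subspace_def tvar_multiples_def omega_scale_Pair)

lemma basis_act_tvar_multiples:
  assumes "v \<in> tvar_multiples"
  shows "basis_act lam 0 h a v \<in> tvar_multiples"
proof -
  obtain f k where v: "v = (f, k)" by (cases v)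
  have "tvar dvd shift c f" "tvar dvd shift c k" for c
    using assms v by (auto simp: tvar_multiples_def intro: tvar_dvd_shift)
  then show ?thesis unfolding v
    by (cases a) (auto simp: act_L act_W act_G act_zero_C tvar_multiples_def cst_0
        intro!: dvd_mult dvd_diff)
qed

lemma tvar_multiples_proper: "tvar_multiples \<noteq> {0}" "tvar_multiples \<noteq> UNIV"
proof -
  have "(tvar, 0) \<in> tvar_multiples" "(tvar, 0) \<noteq> (0 :: omega_space)"
    by (simp_all add: tvar_multiples_def zero_prod_def tvar_def)
  then show "tvar_multiples \<noteq> {0}" by blast
  have "\<not> tvar dvd (1 :: complex poly poly)"
    by (auto simp: tvar_def is_unit_const_poly_iff is_unit_pCons_iff)
  then have "(1, 0) \<notin> tvar_multiples" by (simp add: tvar_multiples_def)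
  then show "tvar_multiples \<noteq> UNIV" by blast
qed

theorem corollary2p11:
  fixes lam \<alpha> :: complex and h :: "complex poly"
  assumes "lam \<noteq> 0"
  shows "simple_lie_supermodule bms_scale bms_part bms_bracket
           omega_scale omega_part (omega_act lam \<alpha> h) \<longleftrightarrow> \<alpha> \<noteq> 0"
proof
  assume simple: "simple_lie_supermodule bms_scale bms_part bms_bracket
           omega_scale omega_part (omega_act lam \<alpha> h)"
  then interpret S: simple_lie_supermodule bms_scale bms_part bms_bracket omega_scale omega_part
    "omega_act lam \<alpha> h" .
  show "\<alpha> \<noteq> 0"
  proof
    assume \<alpha>: "\<alpha> = 0"
    have "S.graded_submodule tvar_multiples"
      unfolding S.graded_submodule_def
    proof (intro conjI allI ballI)
      show "omega.subspace tvar_multiples" by (rule subspace_tvar_multiples)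
      show "omega_act lam \<alpha> h x v \<in> tvar_multiples" if "v \<in> tvar_multiples" for x v
        using omega_act_closed[OF subspace_tvar_multiples basis_act_tvar_multiples[OF that]] \<alpha>
        by simp
      show "\<exists>u\<in>tvar_multiples \<inter> omega_part 0. \<exists>w\<in>tvar_multiples \<inter> omega_part 1. v = u + w"
        if "v \<in> tvar_multiples" for v
        using that by (intro bexI[of _ "(fst v, 0)"] bexI[of _ "(0, snd v)"])
          (auto simp: tvar_multiples_def omega_part_def)
    qed
    then show False using S.no_proper_submodule tvar_multiples_proper by blast
  qed
next
  assume \<alpha>: "\<alpha> \<noteq> 0"
  interpret M: lie_supermodule bms_scale bms_part bms_bracket omega_scale omega_part
    "omega_act lam \<alpha> h"
    using assms by (rule lie_supermodule_omega)
  show "simple_lie_supermodule bms_scale bms_part bms_bracket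
           omega_scale omega_part (omega_act lam \<alpha> h)"
  proof unfold_locales
    show "\<exists>v :: omega_space. v \<noteq> 0" by (rule exI[of _ "(1, 0)"]) (simp add: zero_prod_def)
    show "N = {0} \<or> N = UNIV" if "M.graded_submodule N" for N
      using assms \<alpha> that by (rule graded_submodule_trivial)
  qed
qed

end
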